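(* In any topological space, each countable Pytkeev network is a $k$-network. Consequently, each $\mathfrak P_0$-space is an $\aleph_0$-space.
   Context: Compactness does not include any separation axiom; "regular" means $T_3$. A subset $A$ of a topological space $X$ accumulates at a point $x\in X$ if each neighborhood of $x$ contains infinitely many points of $A$. A family $\mathcal N$ of subsets of $X$ is a network at $x\in X$ if for any neighborhood $O_x$ of $x$ there is $N\in\mathcal N$ with $x\in N\subset O_x$. It is a Pytkeev network at $x$ if it is a network at $x$ and for each neighborhood $O_x$ of $x$ and each subset $A\subset X$ accumulating at $x$ there is $N\in\mathcal N$ such that $N\subset O_x$ and $N\cap A$ is infinite. It is a Pytkeev network for $X$ if it is a Pytkeev network at each point $x\in X$. A family $\mathcal N$ of subsets of $X$ is a $k$-network if for each open set $U\subset X$ and each compact subset $K\subset U$ there is a finite subfamily $\mathcal F\subset\mathcal N$ such that $K\subset\bigcup\mathcal F\subset U$. A $\mathfrak P_0$-space is a regular space with a countable Pytkeev network. An $\aleph_0$-space is a regular space with a countable $k$-network. *)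

theory Defs
  imports "HOL-Analysis.Analysis"
begin

text \<open>Neighborhoods are not required to be open.\<close>

definition nbhd_of :: "'a topology \<Rightarrow> 'a \<Rightarrow> 'a set \<Rightarrow> bool" where
  "nbhd_of X x W \<longleftrightarrow> W \<subseteq> topspace X \<and> (\<exists>U. openin X U \<and> x \<in> U \<and> U \<subseteq> W)"

text \<open>In spaces that are not \<open>T\<^sub>1\<close>, accumulation is stronger than membership in the
  library's \<open>derived_set_of\<close>, which only asks for one further point of \<open>A\<close>.\<close>

definition accumulates_at :: "'a topology \<Rightarrow> 'a set \<Rightarrow> 'a \<Rightarrow> bool" where
  "accumulates_at X A x \<longleftrightarrow>
     A \<subseteq> topspace X \<and> x \<in> topspace X \<and> (\<forall>W. nbhd_of X x W \<longrightarrow> infinite (W \<inter> A))"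

definition network_at :: "'a topology \<Rightarrow> 'a set set \<Rightarrow> 'a \<Rightarrow> bool" where
  "network_at X \<N> x \<longleftrightarrow>
     \<N> \<subseteq> Pow (topspace X) \<and> x \<in> topspace X \<and>
     (\<forall>W. nbhd_of X x W \<longrightarrow> (\<exists>N\<in>\<N>. x \<in> N \<and> N \<subseteq> W))"

definition Pytkeev_network_at :: "'a topology \<Rightarrow> 'a set set \<Rightarrow> 'a \<Rightarrow> bool" where
  "Pytkeev_network_at X \<N> x \<longleftrightarrow>
     network_at X \<N> x \<and>
     (\<forall>W A. nbhd_of X x W \<and> accumulates_at X A x \<longrightarrow>
        (\<exists>N\<in>\<N>. N \<subseteq> W \<and> infinite (N \<inter> A)))"

definition Pytkeev_network :: "'a topology \<Rightarrow> 'a set set \<Rightarrow> bool" where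
  "Pytkeev_network X \<N> \<longleftrightarrow>
     \<N> \<subseteq> Pow (topspace X) \<and> (\<forall>x\<in>topspace X. Pytkeev_network_at X \<N> x)"

definition k_network :: "'a topology \<Rightarrow> 'a set set \<Rightarrow> bool" where
  "k_network X \<N> \<longleftrightarrow>
     \<N> \<subseteq> Pow (topspace X) \<and>
     (\<forall>U K. openin X U \<and> compactin X K \<and> K \<subseteq> U \<longrightarrow>
        (\<exists>\<F>. finite \<F> \<and> \<F> \<subseteq> \<N> \<and> K \<subseteq> \<Union>\<F> \<and> \<Union>\<F> \<subseteq> U))"

text \<open>The library's \<^const>\<open>regular_space\<close> carries no \<open>T\<^sub>1\<close> assumption.\<close>

definition T3_space :: "'a topology \<Rightarrow> bool" where
  "T3_space X \<longleftrightarrow> regular_space X \<and> t1_space X"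

definition P0_space :: "'a topology \<Rightarrow> bool" where
  "P0_space X \<longleftrightarrow> T3_space X \<and> (\<exists>\<N>. countable \<N> \<and> Pytkeev_network X \<N>)"

definition aleph0_space :: "'a topology \<Rightarrow> bool" where
  "aleph0_space X \<longleftrightarrow> T3_space X \<and> (\<exists>\<N>. countable \<N> \<and> k_network X \<N>)"

end

theory Submission
  imports Defs
begin

text \<open>
  Let \<open>K \<subseteq> U\<close> with \<open>K\<close> compact and \<open>U\<close> open, and consider the countably many members of the
  Pytkeev network that lie in \<open>U\<close>. The network property makes them cover \<open>K\<close>. If no finitely many
  of them did, a diagonal choice along an enumeration would give an infinite \<open>A \<subseteq> K\<close> that meets each of
  them in a finite set only (\<open>countable_cover_diagonal\<close>). By compactness \<open>A\<close> accumulates at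
  some point of \<open>K\<close> (\<open>compactin_imp_accumulates_at\<close>), and the Pytkeev property at that point yields
  a member inside \<open>U\<close> with infinite trace on \<open>A\<close>, a contradiction.
\<close>

text \<open>If every point had a neighborhood with finite trace on \<open>A\<close>, finitely many of these
  neighborhoods would cover \<open>K\<close> and so leave only finitely many points for \<open>A\<close>.\<close>

lemma compactin_imp_accumulates_at:
  assumes K: "compactin X K" and AK: "A \<subseteq> K" and inf: "infinite A"
  obtains x where "x \<in> K" "accumulates_at X A x"
proof -
  have KX: "K \<subseteq> topspace X"
    using K by (rule compactin_subset_topspace)
  have "\<exists>x\<in>K. accumulates_at X A x"
  proof (rule ccontr)
    assume neg: "\<not> (\<exists>x\<in>K. accumulates_at X A x)"
    let ?C = "{V. openin X V \<and> finite (V \<inter> A)}"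
    have "x \<in> \<Union>?C" if xK: "x \<in> K" for x
    proof -
      obtain W where W: "nbhd_of X x W" and fin: "finite (W \<inter> A)"
        using neg xK subset_trans[OF AK KX] subsetD[OF KX xK]
        unfolding accumulates_at_def by auto
      from W obtain V where V: "openin X V" "x \<in> V" "V \<subseteq> W"
        unfolding nbhd_of_def by blast
      have "finite (V \<inter> A)"
        using fin by (rule rev_finite_subset) (use V in blast)
      with V show ?thesis by blast
    qed
    then obtain \<F> where \<F>: "finite \<F>" "\<F> \<subseteq> ?C" "K \<subseteq> \<Union>\<F>"
      using compactinD[OF K, of ?C] by (metis (no_types, lifting) mem_Collect_eq subsetI)
    have "A \<subseteq> (\<Union>V\<in>\<F>. V \<inter> A)"
    proof
      fix y assume "y \<in> A"
      then show "y \<in> (\<Union>V\<in>\<F>. V \<inter> A)"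
        using subsetD[OF subset_trans[OF AK \<F>(3)]] by blast
    qed
    moreover have "finite (\<Union>V\<in>\<F>. V \<inter> A)"
      by (rule finite_UN_I) (use \<F>(1,2) in auto)
    ultimately show False
      using inf finite_subset by blast
  qed
  then show thesis
    using that by blast
qed

text \<open>Picking the \<open>n\<close>-th point outside the first \<open>n + 1\<close> members makes the trace on each member
  finite. The covering hypothesis is what forces infinitely many distinct points: the member that
  contains a given value excludes that value from all later choices.\<close>

lemma countable_cover_diagonal:
  assumes "countable \<M>" and cover: "K \<subseteq> \<Union>\<M>"
    and nofin: "\<And>\<F>. finite \<F> \<Longrightarrow> \<F> \<subseteq> \<M> \<Longrightarrow> \<not> K \<subseteq> \<Union>\<F>"
  obtains A where "A \<subseteq> K" "infinite A" "\<And>N. N \<in> \<M> \<Longrightarrow> finite (N \<inter> A)"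
proof -
  have "\<M> \<noteq> {}"
    using nofin[of "{}"] cover by auto
  then obtain M :: "nat \<Rightarrow> 'a set" where M: "range M = \<M>"
    using \<open>countable \<M>\<close> uncountable_def by metis
  have "\<exists>x. x \<in> K \<and> (\<forall>i\<le>n. x \<notin> M i)" for n
  proof -
    have "\<not> K \<subseteq> \<Union>(M ` {..n})"
      by (rule nofin) (use M in auto)
    then show ?thesis by blast
  qed
  then obtain a where aK: "\<And>n. a n \<in> K" and aM: "\<And>n i. i \<le> n \<Longrightarrow> a n \<notin> M i"
    by metis
  have trace: "M i \<inter> range a \<subseteq> a ` {..<i}" for i
    using aM not_le by blast
  have "infinite (range a)"
  proof
    assume "finite (range a)"
    then obtain y where y: "infinite {n. a n = y}"
      using pigeonhole_infinite[of UNIV a] by auto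
    have "y \<in> K"
      using y aK by (metis (mono_tags, lifting) mem_Collect_eq not_finite_existsD)
    then obtain i where "y \<in> M i"
      using cover M by blast
    then have "{n. a n = y} \<subseteq> {..<i}"
      using aM not_le by blast
    with y show False
      using finite_subset by blast
  qed
  moreover have "finite (N \<inter> range a)" if "N \<in> \<M>" for N
    using that M trace by (metis finite_imageI finite_lessThan finite_subset rangeE)
  ultimately show thesis
    using that[of "range a"] aK by blast
qed

lemma countable_Pytkeev_network_imp_k_network:
  assumes count: "countable \<N>" and Pyt: "Pytkeev_network X \<N>"
  shows "k_network X \<N>"
  unfolding k_network_def
proof (intro conjI allI impI)
  show "\<N> \<subseteq> Pow (topspace X)"
    using Pyt unfolding Pytkeev_network_def by blast
next
  fix U K
  assume "openin X U \<and> compactin X K \<and> K \<subseteq> U"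
  then have U: "openin X U" and K: "compactin X K" and KU: "K \<subseteq> U"
    by auto
  let ?M = "{N \<in> \<N>. N \<subseteq> U}"
  have nbhd: "nbhd_of X x U" if "x \<in> K" for x
    unfolding nbhd_of_def using U KU that openin_subset by blast
  have PytK: "Pytkeev_network_at X \<N> x" if "x \<in> K" for x
    using Pyt that compactin_subset_topspace[OF K] unfolding Pytkeev_network_def by blast
  have cover: "K \<subseteq> \<Union>?M"
  proof
    fix x assume "x \<in> K"
    then show "x \<in> \<Union>?M"
      using nbhd PytK unfolding Pytkeev_network_at_def network_at_def by blast
  qed
  show "\<exists>\<F>. finite \<F> \<and> \<F> \<subseteq> \<N> \<and> K \<subseteq> \<Union>\<F> \<and> \<Union>\<F> \<subseteq> U"
  proof (rule ccontr)
    assume neg: "\<not> ?thesis"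
    have nofin: "\<not> K \<subseteq> \<Union>\<F>" if "finite \<F>" "\<F> \<subseteq> ?M" for \<F>
      using neg that by blast
    have "countable ?M"
      using count by (rule countable_subset[rotated]) blast
    then obtain A where A: "A \<subseteq> K" "infinite A" and fin: "\<And>N. N \<in> ?M \<Longrightarrow> finite (N \<inter> A)"
      using countable_cover_diagonal[OF _ cover nofin] by blast
    obtain x where x: "x \<in> K" "accumulates_at X A x"
      using compactin_imp_accumulates_at[OF K A] .
    then obtain N where "N \<in> \<N>" "N \<subseteq> U" "infinite (N \<inter> A)"
      using nbhd PytK unfolding Pytkeev_network_at_def by blast
    with fin show False by blast
  qed
qed

theorem proposition1p6:
  fixes X :: "'a topology"
  shows "(\<forall>\<N>. countable \<N> \<and> Pytkeev_network X \<N> \<longrightarrow> k_network X \<N>) \<and>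
         (P0_space X \<longrightarrow> aleph0_space X)"
proof
  show "\<forall>\<N>. countable \<N> \<and> Pytkeev_network X \<N> \<longrightarrow> k_network X \<N>"
    by (simp add: countable_Pytkeev_network_imp_k_network)
  then show "P0_space X \<longrightarrow> aleph0_space X"
    unfolding P0_space_def aleph0_space_def by fast
qed

end
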